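(* Let $m\ge n\ge1$ be integers and let $\mathbf z(t)=\sum_{i=0}^m\mathbf z_iN^n_{i,\mu}(t)$, $t\in[t_n,t_{m+1}]$, $\mathbf z_i\in\mathbb C$, be a clamped B-spline curve over the knot partition $\mu=\{\langle t_n\rangle^{n+1},\{t_i\}_{i=n+1,\dots,m},\langle t_{m+1}\rangle^{n+1}\}$ (nondecreasing, $t_n<t_{m+1}$). Put $q=2n+(n+1)(m-n)$ and $$\nu=\{s_i\}_{i=0,\dots,4n+1+(n+1)(m-n)}=\{\langle t_n\rangle^{2n+1},\{\langle t_i\rangle^{n+1}\}_{i=n+1,\dots,m},\langle t_{m+1}\rangle^{2n+1}\},$$ $$\rho=\{\langle t_n\rangle^{2n+2},\{\langle t_i\rangle^{n+1}\}_{i=n+1,\dots,m},\langle t_{m+1}\rangle^{2n+2}\}.$$ Then there are $\mathbf p_0,\dots,\mathbf p_q\in\mathbb C$ with $$\mathbf p(t)=\mathbf z^2(t)=\sum_{k=0}^q\mathbf p_kN^{2n}_{k,\nu}(t),\qquad t\in[t_n,t_{m+1}],$$ and, for arbitrary $\mathbf r_0\in\mathbb C$, with $\mathbf r_{i+1}=\mathbf r_i+\frac{s_{i+2n+1}-s_i}{2n+1}\mathbf p_i$ for $i=0,\dots,q$, the curve $$\mathbf r(t)=\sum_{i=0}^{q+1}\mathbf r_iN^{2n+1}_{i,\rho}(t),\qquad t\in[t_n,t_{m+1}],$$ is an indefinite integral $\int\mathbf p(t)\,dt$ of $\mathbf p$.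
   Context: Normalized B-splines: for a nondecreasing knot sequence $\mu=\{t_i\}$, $N^0_{i,\mu}(t)=1$ if $t\in[t_i,t_{i+1})$ and $0$ otherwise, and $N^n_{i,\mu}(t)=\frac{t-t_i}{t_{i+n}-t_i}N^{n-1}_{i,\mu}(t)+\frac{t_{i+n+1}-t}{t_{i+n+1}-t_{i+1}}N^{n-1}_{i+1,\mu}(t)$ with $0/0=0$. Basis functions are indexed by the position (starting at $0$) of their first knot in the partition. $\langle t\rangle^k$ denotes the knot $t$ repeated $k$ times. At the right end of the domain, values are understood as left limits. Points of $\mathbb R^2$ are identified with complex numbers. "Indefinite integral" means $\mathbf r(t)-\mathbf r(t_n)=\int_{t_n}^t\mathbf p(x)\,dx$ on $[t_n,t_{m+1}]$. *)

theory Defs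
  imports "HOL-Analysis.Analysis"
begin

(* A knot sequence is a list; bspline \<mu> n i is the basis function of degree n whose first knot is \<mu> ! i.
   It is only meaningful for i + n + 1 < length \<mu>.  The convention 0/0 = 0 is the division
   convention of HOL: if a denominator vanishes, all knots between its two ends coincide and the
   adjoining basis function of lower degree is identically 0. *)
fun bspline :: "real list \<Rightarrow> nat \<Rightarrow> nat \<Rightarrow> real \<Rightarrow> real" where
  "bspline \<mu> 0 i x = (if \<mu> ! i \<le> x \<and> x < \<mu> ! (i + 1) then 1 else 0)"
| "bspline \<mu> (Suc n) i x =
     (x - \<mu> ! i) / (\<mu> ! (i + Suc n) - \<mu> ! i) * bspline \<mu> n i x
     + (\<mu> ! (i + Suc n + 1) - x) / (\<mu> ! (i + Suc n + 1) - \<mu> ! (i + 1)) * bspline \<mu> n (i + 1) x"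

(* For clamped knots the right end of the domain is the last knot.  The half-open intervals in
   degree 0 make every basis function vanish there, so its value is replaced by the left limit. *)
definition clamped_bspline :: "real list \<Rightarrow> nat \<Rightarrow> nat \<Rightarrow> real \<Rightarrow> real" where
  "clamped_bspline \<mu> n i x =
     (if x = last \<mu> then Lim (at_left x) (bspline \<mu> n i) else bspline \<mu> n i x)"

definition bspline_curve :: "real list \<Rightarrow> nat \<Rightarrow> nat \<Rightarrow> (nat \<Rightarrow> complex) \<Rightarrow> real \<Rightarrow> complex" where
  "bspline_curve \<mu> n N c x = (\<Sum>i = 0..N. c i * complex_of_real (clamped_bspline \<mu> n i x))"

(* e copies of t n, then k copies of each of t (n+1), ..., t m, then e copies of t (m+1).
   Repetition is per index, so coinciding interior knots accumulate their copies. *)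
definition clamped_knots :: "nat \<Rightarrow> nat \<Rightarrow> (nat \<Rightarrow> real) \<Rightarrow> nat \<Rightarrow> nat \<Rightarrow> real list" where
  "clamped_knots e k t n m =
     replicate e (t n) @ concat (map (\<lambda>i. replicate k (t i)) [n + 1..<m + 1])
     @ replicate e (t (m + 1))"

lemma length_clamped_knots: "length (clamped_knots e k t n m) = 2 * e + k * (m - n)"
proof -
  have "length (concat (map (\<lambda>i. replicate k (t i)) xs)) = k * length xs" for xs
    by (induction xs) auto
  then show ?thesis
    unfolding clamped_knots_def by (simp del: upt_Suc)
qed

end

theory Submission
  imports Defs
begin

text \<open>
  The cumulative sums $G^d_i = \sum_{j \ge i} N^d_j$ satisfy the two-term recursion
  $G^{d+1}_i = \omega_i G^d_i + (1 - \omega_i) G^d_{i+1}$ with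
  $\omega_i(x) = (x - s_i) / (s_{i+d+1} - s_i)$, and integration by parts shows
  $(s_{i+d+1} - s_i) G^{d+1}_i(x) = (d+1) \int_{-\infty}^x N^d_i$. Summation by parts then turns
  this into the integration formula, and coinciding knots need no special treatment:
  $G^d_i$ is the indicator function of $[s_i, \infty)$ if $s_i = s_{i+d}$.

  By induction on the degree, the same identity shows that a spline space is spanned by the truncated
  powers $(x - \tau)_+^e$, $e \le d$, for which $\tau$ is a knot of multiplicity at least
  $d + 1 - e$. In this basis the product of two splines is read off from the binomial theorem.
  The value at the right end of the domain is obtained as a left limit.
\<close>

section \<open>Linear spans on a set of arguments\<close>

text \<open>\<open>f\<close> lies, on \<open>X\<close>, in the linear span of \<open>B\<close>. The
  inductive form lets linear facts be proved one summand at a time, and values outside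
  \<open>X\<close> are left free because the spline identities are wanted only left of the right end
  of the domain.\<close>

inductive lspan :: "real set \<Rightarrow> (real \<Rightarrow> real) set \<Rightarrow> (real \<Rightarrow> real) \<Rightarrow> bool"
  for X :: "real set" and B :: "(real \<Rightarrow> real) set"
where
  lspan_zero: "(\<And>x. x \<in> X \<Longrightarrow> f x = 0) \<Longrightarrow> lspan X B f"
| lspan_step: "b \<in> B \<Longrightarrow> lspan X B f \<Longrightarrow> (\<And>x. x \<in> X \<Longrightarrow> g x = c * b x + f x) \<Longrightarrow> lspan X B g"

lemma lspan_cong:
  assumes "lspan X B f" "\<And>x. x \<in> X \<Longrightarrow> g x = f x"
  shows "lspan X B g"
  using assms
proof (induction arbitrary: g)
  case (lspan_zero f)
  show ?case by (rule lspan.lspan_zero) (simp add: lspan_zero)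
next
  case (lspan_step b f h c)
  from lspan_step.hyps(1,2) show ?case
    by (rule lspan.lspan_step[where c = c]) (simp add: lspan_step.prems lspan_step.hyps(3))
qed

lemma lspan_base: "b \<in> B \<Longrightarrow> lspan X B b"
  by (rule lspan_step[where c = 1 and f = "\<lambda>_. 0"]) (simp_all add: lspan_zero)

lemma lspan_add:
  assumes "lspan X B f" "lspan X B g"
  shows "lspan X B (\<lambda>x. f x + g x)"
  using assms
proof (induction)
  case (lspan_zero f)
  from lspan_zero.prems show ?case by (rule lspan_cong) (simp add: lspan_zero.hyps)
next
  case (lspan_step b f h c)
  show ?case
    by (rule lspan.lspan_step[where b = b and c = c and f = "\<lambda>x. f x + g x"])
       (simp_all add: lspan_step.hyps(1,3) lspan_step.IH lspan_step.prems)
qed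

lemma lspan_scale:
  assumes "lspan X B f"
  shows "lspan X B (\<lambda>x. c * f x)"
  using assms
proof (induction)
  case (lspan_zero f)
  show ?case by (rule lspan.lspan_zero) (simp add: lspan_zero)
next
  case (lspan_step b f h c')
  show ?case
    by (rule lspan.lspan_step[where b = b and c = "c * c'" and f = "\<lambda>x. c * f x"])
       (simp_all add: lspan_step.hyps(1,3) lspan_step.IH algebra_simps)
qed

lemma lspan_diff:
  assumes "lspan X B f" "lspan X B g"
  shows "lspan X B (\<lambda>x. f x - g x)"
  by (rule lspan_cong[OF lspan_add[OF assms(1) lspan_scale[OF assms(2), of "-1"]]]) simp

lemma lspan_sum:
  assumes "\<And>i. i \<in> I \<Longrightarrow> lspan X B (f i)"
  shows "lspan X B (\<lambda>x. \<Sum>i\<in>I. f i x)"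
  using assms
proof (induction I rule: infinite_finite_induct)
  case (insert i I)
  have "lspan X B (\<lambda>x. f i x + (\<Sum>i\<in>I. f i x))"
    by (intro lspan_add insert) auto
  with insert.hyps show ?case by simp
qed (simp_all add: lspan_zero)

lemma lspan_trans:
  assumes "lspan X B f" "\<And>b. b \<in> B \<Longrightarrow> lspan X C b"
  shows "lspan X C f"
  using assms(1)
proof (induction)
  case (lspan_zero f)
  then show ?case by (rule lspan.lspan_zero)
next
  case (lspan_step b f g c)
  show ?case
    by (rule lspan_cong[OF lspan_add[OF lspan_scale[OF assms(2)] lspan_step.IH]])
       (use lspan_step in auto)
qed

lemma lspan_mult:
  assumes "lspan X B f" "lspan X B' g"
    and "\<And>b b'. b \<in> B \<Longrightarrow> b' \<in> B' \<Longrightarrow> lspan X C (\<lambda>x. b x * b' x)"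
  shows "lspan X C (\<lambda>x. f x * g x)"
proof -
  have *: "lspan X C (\<lambda>x. b x * g x)" if "b \<in> B" for b
    using assms(2)
  proof (induction)
    case (lspan_zero f)
    then show ?case by (intro lspan.lspan_zero) auto
  next
    case (lspan_step b' f g c)
    show ?case
      by (rule lspan_cong[OF lspan_add[OF lspan_scale[OF assms(3)[OF that lspan_step.hyps(1)]]
              lspan_step.IH]]) (use lspan_step in \<open>auto simp: algebra_simps\<close>)
  qed
  show ?thesis
    using assms(1)
  proof (induction)
    case (lspan_zero f)
    then show ?case by (intro lspan.lspan_zero) auto
  next
    case (lspan_step b f h c)
    show ?case
      by (rule lspan_cong[OF lspan_add[OF lspan_scale[OF *[OF lspan_step.hyps(1)]]
              lspan_step.IH]]) (use lspan_step in \<open>auto simp: algebra_simps\<close>)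
  qed
qed

lemma lspan_image_coeffs:
  assumes "lspan X (h ` I) f" "finite I"
  shows "\<exists>c. \<forall>x\<in>X. f x = (\<Sum>i\<in>I. c i * h i x)"
  using assms(1)
proof (induction)
  case (lspan_zero f)
  then show ?case by (intro exI[of _ "\<lambda>_. 0"]) auto
next
  case (lspan_step b f g c)
  then obtain k c' where k: "k \<in> I" "b = h k" and c': "\<forall>x\<in>X. f x = (\<Sum>i\<in>I. c' i * h i x)"
    by auto
  have "(\<Sum>i\<in>I. (c' i + (if i = k then c else 0)) * h i x) = (\<Sum>i\<in>I. c' i * h i x) + c * h k x" for x
    using k assms(2)
    by (simp add: distrib_right sum.distrib if_distrib[of "\<lambda>u. u * _"] sum.delta cong: if_cong)
  then show ?case
    using lspan_step.hyps(3) c' k(2)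
    by (intro exI[of _ "\<lambda>i. c' i + (if i = k then c else 0)"]) (simp add: add.commute)
qed

text \<open>Integration from \<open>A\<close> is linear, so generators suffice. The second
  hypothesis keeps the domain of integration within \<open>X\<close>, where alone \<open>f\<close>
  is known. \<open>F\<close> is generalized in the induction because the step applies the induction
  hypothesis to \<open>F x - c * G x\<close>.\<close>

lemma lspan_integral:
  assumes "lspan X B f"
    and "\<And>x. x \<in> X \<Longrightarrow> {A..x} \<subseteq> X"
    and "\<And>b. b \<in> B \<Longrightarrow> \<exists>G. (\<forall>x\<in>X. (b has_integral G x) {A..x}) \<and> lspan X C G"
    and "\<And>x. x \<in> X \<Longrightarrow> (f has_integral F x) {A..x}"
  shows "lspan X C F"
  using assms(1,4)
proof (induction arbitrary: F)
  case (lspan_zero f)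
  have "F x = 0" if "x \<in> X" for x
  proof -
    have "(f has_integral 0) {A..x}"
      using lspan_zero.hyps assms(2)[OF that] by (intro has_integral_is_0) auto
    then show ?thesis using lspan_zero.prems[OF that] has_integral_unique by blast
  qed
  then show ?case by (rule lspan.lspan_zero)
next
  case (lspan_step b f g c)
  obtain G where G: "\<forall>x\<in>X. (b has_integral G x) {A..x}" "lspan X C G"
    using assms(3)[OF lspan_step.hyps(1)] by blast
  have "(f has_integral (F x - c * G x)) {A..x}" if "x \<in> X" for x
  proof -
    have "((\<lambda>y. g y - c * b y) has_integral (F x - c * G x)) {A..x}"
      using lspan_step.prems[OF that] G(1) that
      by (intro has_integral_diff has_integral_mult_right) auto
    moreover have "g y - c * b y = f y" if "y \<in> {A..x}" for y
      using lspan_step.hyps(3) assms(2)[OF \<open>x \<in> X\<close>] that by auto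
    ultimately show ?thesis by (rule has_integral_eq[rotated])
  qed
  then have "lspan X C (\<lambda>x. F x - c * G x)" by (rule lspan_step.IH)
  from lspan_add[OF this lspan_scale[OF G(2), of c]] show ?case
    by (rule lspan_cong) simp
qed

section \<open>Truncated powers\<close>

text \<open>Deciding by \<open>\<tau> \<le> x\<close> makes \<open>tpow \<tau> 0\<close> the
  indicator of [\<tau>, infinity), which matches the half-open intervals of degree 0;
  \<open>max 0 (x - \<tau>) ^ 0\<close> would be 1 everywhere.\<close>

definition tpow :: "real \<Rightarrow> nat \<Rightarrow> real \<Rightarrow> real" where
  "tpow \<tau> e x = (if \<tau> \<le> x then (x - \<tau>) ^ e else 0)"

lemma tpow_has_integral:
  assumes "A \<le> \<tau>" "A \<le> x"
  shows "(tpow \<tau> e has_integral tpow \<tau> (Suc e) x / real (Suc e)) {A..x}"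
proof (cases "\<tau> \<le> x")
  case False
  then have "(tpow \<tau> e has_integral 0) {A..x}"
    by (intro has_integral_is_0) (auto simp: tpow_def)
  with False show ?thesis by (simp add: tpow_def)
next
  case True
  \<comment> \<open>For \<open>e = 0\<close> the integrand is 1 at \<tau> itself, so it vanishes on
    this interval only up to one point.\<close>
  have "(tpow \<tau> e has_integral 0) {A..\<tau>}"
    by (rule has_integral_spike_finite[where S = "{\<tau>}" and f = "\<lambda>_. 0"])
       (auto simp: tpow_def)
  moreover have "((\<lambda>y. (y - \<tau>) ^ e) has_integral
      (x - \<tau>) ^ Suc e / real (Suc e) - (\<tau> - \<tau>) ^ Suc e / real (Suc e)) {\<tau>..x}"
  proof (intro fundamental_theorem_of_calculus True)
    fix y assume "y \<in> {\<tau>..x}"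
    have "((\<lambda>y. (y - \<tau>) ^ Suc e / real (Suc e)) has_field_derivative (y - \<tau>) ^ e)
        (at y within {\<tau>..x})"
      by (auto intro!: derivative_eq_intros simp del: of_nat_Suc power_Suc)
    then show "((\<lambda>y. (y - \<tau>) ^ Suc e / real (Suc e)) has_vector_derivative (y - \<tau>) ^ e)
        (at y within {\<tau>..x})"
      by (simp add: has_real_derivative_iff_has_vector_derivative)
  qed
  from this have "(tpow \<tau> e has_integral
      (x - \<tau>) ^ Suc e / real (Suc e) - (\<tau> - \<tau>) ^ Suc e / real (Suc e)) {\<tau>..x}"
    by (rule has_integral_eq[rotated]) (auto simp: tpow_def)
  then have "(tpow \<tau> e has_integral (x - \<tau>) ^ Suc e / real (Suc e)) {\<tau>..x}"
    by simp
  ultimately have "(tpow \<tau> e has_integral 0 + (x - \<tau>) ^ Suc e / real (Suc e)) {A..x}"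
    by (rule has_integral_combine[OF assms(1) True])
  with True show ?thesis by (simp add: tpow_def)
qed

lemma tpow_left_limit: "\<exists>l. (tpow \<tau> e \<longlongrightarrow> l) (at_left b)"
proof (cases "\<tau> < b")
  case True
  have "((\<lambda>x. (x - \<tau>) ^ e) \<longlongrightarrow> (b - \<tau>) ^ e) (at_left b)"
    by (intro tendsto_intros)
  moreover have "\<forall>\<^sub>F x in at_left b. (x - \<tau>) ^ e = tpow \<tau> e x"
    using eventually_at_left_real[OF True] by eventually_elim (auto simp: tpow_def)
  ultimately show ?thesis by (intro exI) (rule Lim_transform_eventually)
next
  case False
  have "\<forall>\<^sub>F x in at_left b. tpow \<tau> e x = 0"
    unfolding eventually_at_filter using False by (intro always_eventually) (auto simp: tpow_def)
  then show ?thesis by (intro exI) (rule tendsto_eventually)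
qed

text \<open>The product lives on [\<sigma>, infinity), and there \<open>x - \<tau>\<close> is
  expanded about the larger knot as \<open>(x - \<sigma>) + (\<sigma> - \<tau>)\<close>. Hence only
  powers at \<sigma> appear.\<close>

lemma tpow_mult:
  assumes "\<tau> \<le> \<sigma>"
  shows "tpow \<tau> e x * tpow \<sigma> e' x
    = (\<Sum>l\<le>e. real (e choose l) * (\<sigma> - \<tau>) ^ (e - l) * tpow \<sigma> (e' + l) x)"
proof (cases "\<sigma> \<le> x")
  case True
  have "(x - \<tau>) ^ e = ((x - \<sigma>) + (\<sigma> - \<tau>)) ^ e" by simp
  also have "\<dots> = (\<Sum>l\<le>e. real (e choose l) * (x - \<sigma>) ^ l * (\<sigma> - \<tau>) ^ (e - l))"
    by (rule binomial_ring)
  finally show ?thesis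
    using True assms by (simp add: tpow_def sum_distrib_left sum_distrib_right power_add mult_ac)
qed (simp add: tpow_def)

definition tpows_from :: "real \<Rightarrow> (real \<Rightarrow> real) set" where
  "tpows_from A = {tpow \<tau> e |\<tau> e. A \<le> \<tau>}"

text \<open>Writing \<open>x - c\<close> as \<open>(x - \<tau>) + (\<tau> - c)\<close> raises the
  exponent by one or keeps it. As \<open>tpows_from A\<close> admits every exponent, it absorbs the
  linear factors of the B-spline recursion.\<close>

lemma lspan_tpows_from_mult_linear:
  assumes "lspan X (tpows_from A) f"
  shows "lspan X (tpows_from A) (\<lambda>x. (x - c) * f x)"
  using assms
proof (induction)
  case (lspan_zero f)
  then show ?case by (intro lspan.lspan_zero) auto
next
  case (lspan_step b f g k)
  obtain \<tau> e where b: "b = tpow \<tau> e" "A \<le> \<tau>"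
    using lspan_step.hyps(1) by (auto simp: tpows_from_def)
  have "lspan X (tpows_from A) (\<lambda>x. k * tpow \<tau> (Suc e) x + (k * (\<tau> - c) * tpow \<tau> e x + (x - c) * f x))"
    using b(2)
    by (intro lspan_add lspan_scale lspan_step.IH lspan_base) (auto simp: tpows_from_def)
  then show ?case
    by (rule lspan_cong) (simp add: lspan_step.hyps(3) b(1) tpow_def algebra_simps)
qed

text \<open>Integration by parts against a linear factor. It is checked on truncated powers, whose
  antiderivatives are explicit, so jumps of \<open>f\<close> at the knots do no harm.\<close>

lemma lspan_tpows_from_by_parts:
  assumes "lspan {A..} (tpows_from A) f"
  shows "\<exists>F G. \<forall>x\<ge>A. (f has_integral F x) {A..x} \<and> (F has_integral G x) {A..x} \<and>
    ((\<lambda>y. (y - c) * f y) has_integral (x - c) * F x - G x) {A..x}"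
  using assms
proof (induction)
  case (lspan_zero f)
  then show ?case
    by (intro exI[of _ "\<lambda>_. 0"]) (auto intro!: has_integral_is_0)
next
  case (lspan_step b f g k)
  obtain \<tau> e where b: "b = tpow \<tau> e" "A \<le> \<tau>"
    using lspan_step.hyps(1) by (auto simp: tpows_from_def)
  obtain F G where FG: "\<And>x. A \<le> x \<Longrightarrow> (f has_integral F x) {A..x}"
      "\<And>x. A \<le> x \<Longrightarrow> (F has_integral G x) {A..x}"
      "\<And>x. A \<le> x \<Longrightarrow> ((\<lambda>y. (y - c) * f y) has_integral (x - c) * F x - G x) {A..x}"
    using lspan_step.IH by blast
  define H where "H x = tpow \<tau> (Suc e) x / real (Suc e)" for x
  define K where "K x = tpow \<tau> (Suc (Suc e)) x / (real (Suc e) * real (Suc (Suc e)))" for x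
  have H: "(b has_integral H x) {A..x}" if "A \<le> x" for x
    unfolding b H_def using b(2) that by (rule tpow_has_integral)
  have K: "(H has_integral K x) {A..x}" if "A \<le> x" for x
    using has_integral_divide[OF tpow_has_integral[OF b(2) that, of "Suc e"], of "real (Suc e)"]
    by (simp add: H_def[abs_def] K_def field_simps)
  have B: "((\<lambda>y. (y - c) * b y) has_integral (x - c) * H x - K x) {A..x}" if "A \<le> x" for x
  proof -
    have "((\<lambda>y. tpow \<tau> (Suc e) y + (\<tau> - c) * tpow \<tau> e y) has_integral
        tpow \<tau> (Suc (Suc e)) x / real (Suc (Suc e)) + (\<tau> - c) * (tpow \<tau> (Suc e) x / real (Suc e)))
        {A..x}"
      by (intro has_integral_add has_integral_mult_right tpow_has_integral b(2) that)
    moreover have "(\<lambda>y. tpow \<tau> (Suc e) y + (\<tau> - c) * tpow \<tau> e y) = (\<lambda>y. (y - c) * b y)"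
      by (auto simp: b tpow_def algebra_simps)
    moreover have "tpow \<tau> (Suc (Suc e)) x / real (Suc (Suc e))
        + (\<tau> - c) * (tpow \<tau> (Suc e) x / real (Suc e)) = (x - c) * H x - K x"
    proof -
      have "tpow \<tau> (Suc (Suc e)) x = (x - \<tau>) * tpow \<tau> (Suc e) x"
        by (simp add: tpow_def)
      then show ?thesis
        unfolding H_def K_def by (simp add: divide_simps) (simp add: algebra_simps)
    qed
    ultimately show ?thesis by simp
  qed
  show ?case
  proof (intro exI allI impI conjI)
    fix x assume x: "A \<le> x"
    show "(g has_integral k * H x + F x) {A..x}"
      using has_integral_add[OF has_integral_mult_right[OF H[OF x], of k] FG(1)[OF x]]
      by (rule has_integral_eq[rotated]) (use lspan_step.hyps(3) in auto)
    show "((\<lambda>x. k * H x + F x) has_integral k * K x + G x) {A..x}"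
      by (intro has_integral_add has_integral_mult_right K FG x)
    have "((\<lambda>y. (y - c) * g y) has_integral
        k * ((x - c) * H x - K x) + ((x - c) * F x - G x)) {A..x}"
      using has_integral_add[OF has_integral_mult_right[OF B[OF x], of k] FG(3)[OF x]]
      by (rule has_integral_eq[rotated]) (use lspan_step.hyps(3) in \<open>auto simp: algebra_simps\<close>)
    then show "((\<lambda>y. (y - c) * g y) has_integral
        (x - c) * (k * H x + F x) - (k * K x + G x)) {A..x}"
      by (simp add: algebra_simps)
  qed
qed

lemma lspan_tpows_from_left_limit:
  assumes "lspan {A..<b} (tpows_from A) f" "A < b"
  shows "\<exists>l. (f \<longlongrightarrow> l) (at_left b)"
proof -
  have ev: "\<forall>\<^sub>F x in at_left b. x \<in> {A..<b}"
    using eventually_at_left_real[OF assms(2)] by eventually_elim auto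
  show ?thesis
    using assms(1)
  proof (induction)
    case (lspan_zero f)
    have "\<forall>\<^sub>F x in at_left b. f x = 0"
      using ev by eventually_elim (use lspan_zero in auto)
    then show ?case by (intro exI) (rule tendsto_eventually)
  next
    case (lspan_step h f g c)
    obtain l where l: "(f \<longlongrightarrow> l) (at_left b)"
      using lspan_step.IH by blast
    obtain l' where "(h \<longlongrightarrow> l') (at_left b)"
      using lspan_step.hyps(1) tpow_left_limit unfolding tpows_from_def by blast
    with l have "((\<lambda>x. c * h x + f x) \<longlongrightarrow> c * l' + l) (at_left b)"
      by (intro tendsto_intros)
    moreover have "\<forall>\<^sub>F x in at_left b. c * h x + f x = g x"
      using ev by eventually_elim (use lspan_step.hyps(3) in auto)
    ultimately show ?case by (intro exI) (rule Lim_transform_eventually)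
  qed
qed

section \<open>Cumulative B-splines\<close>

text \<open>An infinite knot sequence spares an end index. The recursion is a correction to
  \<open>bcum s d (Suc i)\<close>, so that a vanishing denominator leaves exactly this term, which
  is the right value for coinciding knots.\<close>

fun bcum :: "(nat \<Rightarrow> real) \<Rightarrow> nat \<Rightarrow> nat \<Rightarrow> real \<Rightarrow> real" where
  "bcum s 0 i x = (if s i \<le> x then 1 else 0)"
| "bcum s (Suc d) i x = bcum s d (Suc i) x
     + (x - s i) / (s (i + Suc d) - s i) * (bcum s d i x - bcum s d (Suc i) x)"

definition bdiff :: "(nat \<Rightarrow> real) \<Rightarrow> nat \<Rightarrow> nat \<Rightarrow> real \<Rightarrow> real" where
  "bdiff s d i x = bcum s d i x - bcum s d (Suc i) x"

lemma bcum_shift: "bcum s d (Suc i) x = bcum (\<lambda>j. s (Suc j)) d i x"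
  by (induction d arbitrary: i) auto

lemma mono_eq_between:
  fixes s :: "nat \<Rightarrow> real"
  assumes "mono s" "s i = s k" "i \<le> j" "j \<le> k"
  shows "s j = s i"
  using monoD[OF assms(1,3)] monoD[OF assms(1,4)] assms(2) by simp

text \<open>A zero denominator reduces the recursion to its term with index \<open>Suc i\<close>.
  The knots from there on still coincide, so the descent ends in degree 0 at the same knot.\<close>

lemma bcum_degenerate:
  assumes "mono s" "s i = s (i + d)"
  shows "bcum s d i x = (if s i \<le> x then 1 else 0)"
  using assms(2)
proof (induction d arbitrary: i)
  case (Suc d)
  have "s (Suc i) = s i"
    using assms(1) Suc.prems by (rule mono_eq_between) auto
  with Suc.IH[of "Suc i"] Suc.prems show ?case by simp
qed simp

lemma bdiff_degenerate:
  assumes "mono s" "s i = s (i + Suc d)"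
  shows "bdiff s d i x = 0"
proof -
  have "s (i + d) = s i" "s (Suc i) = s i"
    by (rule mono_eq_between[OF assms]; simp)+
  with bcum_degenerate[OF assms(1), of i d x] bcum_degenerate[OF assms(1), of "Suc i" d x] assms(2)
  show ?thesis by (simp add: bdiff_def)
qed

text \<open>Subtracting the recursions for \<open>i\<close> and \<open>Suc i\<close> gives the
  B-spline recursion, its second weight being \<open>1 - w\<close> with the weight \<open>w\<close>
  of index \<open>Suc i\<close>. If the denominator of \<open>w\<close> is zero this relation
  between the weights fails, but the spline concerned vanishes.\<close>

lemma bdiff_Suc:
  assumes "mono s"
  shows "bdiff s (Suc d) i x = (x - s i) / (s (i + Suc d) - s i) * bdiff s d i x
    + (s (i + Suc d + 1) - x) / (s (i + Suc d + 1) - s (Suc i)) * bdiff s d (Suc i) x"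
proof (cases "s (Suc i) = s (i + Suc d + 1)")
  case True
  then have "bdiff s d (Suc i) x = 0" using assms by (intro bdiff_degenerate) auto
  with True show ?thesis by (auto simp: bdiff_def)
next
  case False
  define w where "w = (x - s (Suc i)) / (s (Suc i + Suc d) - s (Suc i))"
  have w: "(s (i + Suc d + 1) - x) / (s (i + Suc d + 1) - s (Suc i)) = 1 - w"
    using False by (simp add: w_def divide_simps)
  show ?thesis
    unfolding w bdiff_def bcum.simps(2) w_def[symmetric] by (simp only: algebra_simps)
qed

lemma bspline_eq_bdiff:
  assumes "mono s" "\<And>j. j < length \<mu> \<Longrightarrow> \<mu> ! j = s j" "i + d + 1 < length \<mu>"
  shows "bspline \<mu> d i x = bdiff s d i x"
  using assms(3)
proof (induction d arbitrary: i)
  case 0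
  then show ?case
    using monoD[OF assms(1), of i "Suc i"] by (auto simp: bdiff_def assms(2))
next
  case (Suc d)
  then show ?case
    by (simp add: bdiff_Suc[OF assms(1)] assms(2))
qed

text \<open>Clearing denominators removes the exception: if the knots coincide, the two cumulative
  splines on the right are equal and their coefficients cancel.\<close>

lemma bcum_Suc_scaled:
  assumes "mono s"
  shows "(s (i + Suc d) - s i) * bcum s (Suc d) i x
    = (x - s i) * bcum s d i x + (s (i + Suc d) - x) * bcum s d (Suc i) x"
proof (cases "s i = s (i + Suc d)")
  case True
  from bdiff_degenerate[OF assms True, of x] True
  show ?thesis by (simp add: bdiff_def algebra_simps)
next
  case False
  then show ?thesis by (simp add: divide_simps) (simp add: algebra_simps)
qed

section \<open>Integration of B-splines\<close>

lemma bcum_lspan_tpows_from: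
  assumes "\<And>j. A \<le> s j"
  shows "lspan X (tpows_from A) (bcum s d i)"
proof (induction d arbitrary: i)
  case 0
  have "bcum s 0 i = tpow (s i) 0" by (auto simp: tpow_def)
  then show ?case using assms by (auto intro!: lspan_base simp: tpows_from_def)
next
  case (Suc d)
  define h where "h = s (i + Suc d) - s i"
  have "lspan X (tpows_from A) (\<lambda>x. bcum s d (Suc i) x
      + (1 / h) * ((x - s i) * (bcum s d i x - bcum s d (Suc i) x)))"
    by (intro lspan_add lspan_scale lspan_tpows_from_mult_linear lspan_diff Suc.IH)
  then show ?case by (rule lspan_cong) (simp add: h_def)
qed

lemma bdiff_lspan_tpows_from:
  assumes "\<And>j. A \<le> s j"
  shows "lspan X (tpows_from A) (bdiff s d i)"
  unfolding bdiff_def[abs_def] by (intro lspan_diff bcum_lspan_tpows_from assms)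

text \<open>By induction on the degree, the B-spline recursion is integrated, each term by parts.
  The unknown integral comes back on the right-hand side; solving for it leaves the cleared
  recursion of \<open>bcum\<close>.\<close>

lemma bdiff_has_integral:
  assumes s: "mono s" and A: "\<And>j. A \<le> s j" and x: "A \<le> x"
  shows "(bdiff s d i has_integral (s (i + Suc d) - s i) / real (Suc d) * bcum s (Suc d) i x) {A..x}"
  using x
proof (induction d arbitrary: i x)
  case 0
  have "((\<lambda>y. tpow (s i) 0 y - tpow (s (Suc i)) 0 y) has_integral
      tpow (s i) (Suc 0) x / real (Suc 0) - tpow (s (Suc i)) (Suc 0) x / real (Suc 0)) {A..x}"
    by (intro has_integral_diff tpow_has_integral A 0)
  moreover have "(\<lambda>y. tpow (s i) 0 y - tpow (s (Suc i)) 0 y) = bdiff s 0 i"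
    by (auto simp: bdiff_def tpow_def)
  moreover have "tpow (s i) (Suc 0) x / real (Suc 0) - tpow (s (Suc i)) (Suc 0) x / real (Suc 0)
      = (s (i + Suc 0) - s i) / real (Suc 0) * bcum s (Suc 0) i x"
    using bcum_Suc_scaled[OF s, of i 0 x] monoD[OF s, of i "Suc i"]
    by (auto simp: tpow_def)
  ultimately show ?case by simp
next
  case (Suc d)
  \<comment> \<open>If the knots coincide, division by zero makes the second integrand 0, and the
    formula needs \<open>c = s i\<close>. The two uses take \<open>c\<close> to be the first knot of
    index \<open>i\<close> and the last knot \<open>u\<close> of index \<open>Suc i\<close>, so both
    meet this condition.\<close>
  have parts: "\<exists>I. (bcum s (Suc d) i has_integral I) {A..x} \<and>
      ((\<lambda>y. real (Suc d) / (s (i + Suc d) - s i) * ((y - c) * bdiff s d i y)) has_integral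
        (x - c) * bcum s (Suc d) i x - I) {A..x}"
    if c: "s i = s (i + Suc d) \<Longrightarrow> c = s i" for i c
  proof (cases "s i = s (i + Suc d)")
    case True
    have "bcum s (Suc d) i = tpow (s i) 0"
      using bcum_degenerate[OF s True] by (auto simp: tpow_def fun_eq_iff simp del: bcum.simps)
    moreover have "(x - s i) * tpow (s i) 0 x = tpow (s i) (Suc 0) x"
      by (simp add: tpow_def)
    ultimately show ?thesis
      using tpow_has_integral[OF A Suc.prems, of i 0] True c[OF True]
      by (intro exI[of _ "tpow (s i) (Suc 0) x"]) simp
  next
    case False
    define h where "h = s (i + Suc d) - s i"
    have h: "h \<noteq> 0" using False by (simp add: h_def)
    obtain F G where FG: "\<And>x. A \<le> x \<Longrightarrow> (bdiff s d i has_integral F x) {A..x}"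
      "\<And>x. A \<le> x \<Longrightarrow> (F has_integral G x) {A..x}"
      "\<And>x. A \<le> x \<Longrightarrow> ((\<lambda>y. (y - c) * bdiff s d i y) has_integral (x - c) * F x - G x) {A..x}"
      using lspan_tpows_from_by_parts
          [OF bdiff_lspan_tpows_from[of A s "{A..}" d i, OF A], of c] by blast
    \<comment> \<open>Uniqueness of integrals and the induction hypothesis identify \<open>F\<close>
      up to a constant factor.\<close>
    have F: "bcum s (Suc d) i y = real (Suc d) / h * F y" if "A \<le> y" for y
      using has_integral_unique[OF FG(1)[OF that] Suc.IH[OF that]] False
      by (simp add: h_def del: bcum.simps)
    have "((\<lambda>y. real (Suc d) / h * F y) has_integral real (Suc d) / h * G x) {A..x}"
      by (intro has_integral_mult_right FG Suc.prems)
    then have "(bcum s (Suc d) i has_integral real (Suc d) / h * G x) {A..x}"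
      by (rule has_integral_eq[rotated]) (simp add: F del: bcum.simps)
    moreover have "((\<lambda>y. real (Suc d) / h * ((y - c) * bdiff s d i y)) has_integral
        real (Suc d) / h * ((x - c) * F x - G x)) {A..x}"
      by (intro has_integral_mult_right FG Suc.prems)
    moreover have "real (Suc d) / h * ((x - c) * F x - G x)
        = (x - c) * bcum s (Suc d) i x - real (Suc d) / h * G x"
      unfolding F[OF Suc.prems] by (simp only: right_diff_distrib left_diff_distrib mult_ac)
    ultimately show ?thesis
      unfolding h_def by (intro exI[of _ "real (Suc d) / (s (i + Suc d) - s i) * G x"]) simp
  qed
  define u where "u = s (i + Suc (Suc d))"
  obtain I where I: "(bcum s (Suc d) i has_integral I) {A..x}"
      "((\<lambda>y. real (Suc d) / (s (i + Suc d) - s i) * ((y - s i) * bdiff s d i y)) has_integral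
        (x - s i) * bcum s (Suc d) i x - I) {A..x}"
    using parts[of i "s i"] by blast
  obtain I' where I': "(bcum s (Suc d) (Suc i) has_integral I') {A..x}"
      "((\<lambda>y. real (Suc d) / (s (Suc i + Suc d) - s (Suc i)) * ((y - u) * bdiff s d (Suc i) y))
        has_integral (x - u) * bcum s (Suc d) (Suc i) x - I') {A..x}"
    using parts[of "Suc i" u] unfolding u_def by auto
  have V: "(bdiff s (Suc d) i has_integral I - I') {A..x}"
    unfolding bdiff_def[abs_def] by (intro has_integral_diff I I')
  have "((\<lambda>y. real (Suc d) * bdiff s (Suc d) i y) has_integral
      ((x - s i) * bcum s (Suc d) i x - I) - ((x - u) * bcum s (Suc d) (Suc i) x - I')) {A..x}"
    using has_integral_diff[OF I(2) I'(2)]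
  proof (rule has_integral_eq[rotated])
    fix y
    have u: "s (Suc i + Suc d) = u" by (simp add: u_def)
    have "bdiff s (Suc d) i y = (y - s i) / (s (i + Suc d) - s i) * bdiff s d i y
        + (u - y) / (u - s (Suc i)) * bdiff s d (Suc i) y"
      using bdiff_Suc[OF s, of d i y] by (simp add: u_def)
    also have "(u - y) / (u - s (Suc i)) = - ((y - u) / (u - s (Suc i)))"
      by (simp add: minus_divide_left)
    finally show "real (Suc d) / (s (i + Suc d) - s i) * ((y - s i) * bdiff s d i y)
      - real (Suc d) / (s (Suc i + Suc d) - s (Suc i)) * ((y - u) * bdiff s d (Suc i) y)
      = real (Suc d) * bdiff s (Suc d) i y"
      unfolding u by (simp only: distrib_left times_divide_eq_left times_divide_eq_right
          mult_minus_left mult_minus_right add_uminus_conv_diff right_diff_distrib[of "real (Suc d)"])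
  qed
  \<comment> \<open>The same integral is evaluated by parts and as
    \<open>real (Suc d) * (I - I')\<close>. Moving the \<open>I - I'\<close> of the former to the
    left turns the factor into \<open>real (Suc (Suc d))\<close>.\<close>
  from has_integral_unique[OF this has_integral_mult_right[OF V, of "real (Suc d)"]]
  have "real (Suc (Suc d)) * (I - I')
      = (x - s i) * bcum s (Suc d) i x + (u - x) * bcum s (Suc d) (Suc i) x"
    by (simp add: algebra_simps del: bcum.simps)
  also have "\<dots> = (u - s i) * bcum s (Suc (Suc d)) i x"
    unfolding u_def by (rule bcum_Suc_scaled[OF s, symmetric])
  finally have "I - I' = (u - s i) / real (Suc (Suc d)) * bcum s (Suc (Suc d)) i x"
    by (simp add: divide_simps mult.commute del: bcum.simps)
  with V show ?case by (simp add: u_def del: bcum.simps)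
qed

section \<open>The spline space\<close>

text \<open>For monotone \<open>s\<close> the equation says that the \<open>d + 1 - e\<close> knots
  starting at index \<open>j\<close> coincide; \<open>e \<le> d\<close> makes the subtraction exact.
  This is the classical truncated power family of the spline space.\<close>

definition knot_tpows :: "(nat \<Rightarrow> real) \<Rightarrow> nat \<Rightarrow> (real \<Rightarrow> real) set" where
  "knot_tpows s d = {tpow (s j) e |j e. e \<le> d \<and> s j = s (j + (d - e))}"

lemma knot_tpowsI: "e \<le> d \<Longrightarrow> s j = s (j + (d - e)) \<Longrightarrow> tpow (s j) e \<in> knot_tpows s d"
  unfolding knot_tpows_def by blast

text \<open>A nondegenerate \<open>bcum s (Suc d) i\<close> is a multiple of the integral of
  \<open>bdiff s d i\<close>. Integration raises exponent and degree by one, so it preserves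
  \<open>d - e\<close> and the multiplicity that a truncated power demands. In the degenerate case
  the function is an indicator, itself a generator.\<close>

lemma bcum_lspan_knot_tpows:
  assumes s: "mono s" and A: "\<And>j. A \<le> s j"
  shows "lspan {A..<b} (knot_tpows s d) (bcum s d i)"
proof (induction d arbitrary: i)
  case 0
  have "bcum s 0 i = tpow (s i) 0" by (auto simp: tpow_def)
  then show ?case by (simp only:) (intro lspan_base knot_tpowsI, simp_all)
next
  case (Suc d)
  show ?case
  proof (cases "s i = s (i + Suc d)")
    case True
    have "bcum s (Suc d) i = tpow (s i) 0"
      using bcum_degenerate[OF s True] by (auto simp: tpow_def fun_eq_iff simp del: bcum.simps)
    with True knot_tpowsI[of 0 "Suc d" s i] show ?thesis
      by (intro lspan_base) (simp del: bcum.simps)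
  next
    case False
    define h where "h = (s (i + Suc d) - s i) / real (Suc d)"
    have h: "h \<noteq> 0" using False by (simp add: h_def)
    have "lspan {A..<b} (knot_tpows s (Suc d)) (\<lambda>x. h * bcum s (Suc d) i x)"
    proof (rule lspan_integral)
      show "lspan {A..<b} (knot_tpows s d) (bdiff s d i)"
        unfolding bdiff_def[abs_def] by (intro lspan_diff Suc.IH)
      show "\<And>x. x \<in> {A..<b} \<Longrightarrow> {A..x} \<subseteq> {A..<b}" by auto
      show "(bdiff s d i has_integral h * bcum s (Suc d) i x) {A..x}" if "x \<in> {A..<b}" for x
        using bdiff_has_integral[OF s A, of x d i] that by (simp add: h_def del: bcum.simps)
      show "\<exists>G. (\<forall>x\<in>{A..<b}. (f has_integral G x) {A..x}) \<and> lspan {A..<b} (knot_tpows s (Suc d)) G"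
        if f: "f \<in> knot_tpows s d" for f
      proof -
        obtain j e where je: "f = tpow (s j) e" "e \<le> d" "s j = s (j + (d - e))"
          using f by (auto simp: knot_tpows_def)
        have "lspan {A..<b} (knot_tpows s (Suc d)) (\<lambda>x. (1 / real (Suc e)) * tpow (s j) (Suc e) x)"
          using je by (intro lspan_scale lspan_base knot_tpowsI) auto
        moreover have "(f has_integral (1 / real (Suc e)) * tpow (s j) (Suc e) x) {A..x}"
          if "x \<in> {A..<b}" for x
          using tpow_has_integral[OF A, of x j e] that je(1) by simp
        ultimately show ?thesis
          by (intro exI[of _ "\<lambda>x. (1 / real (Suc e)) * tpow (s j) (Suc e) x"]) simp
      qed
    qed
    from lspan_scale[OF this, of "1 / h"] show ?thesis
      by (rule lspan_cong) (simp add: h del: bcum.simps)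
  qed
qed

text \<open>Telescoping from the right: past \<open>q\<close> all knots equal \<open>b\<close>, so
  the cumulative splines vanish on \<open>{A..<b}\<close>, and each step down in the index adds one
  \<open>bdiff\<close>.\<close>

lemma bcum_lspan_bdiff:
  assumes s: "mono s" and q: "\<And>j. q < j \<Longrightarrow> s j = b"
  shows "lspan {A..<b} (bdiff s d ` {0..q}) (bcum s d i)"
proof (induction "Suc q - i" arbitrary: i)
  case 0
  then have "s i = b" "s (i + d) = b" by (simp_all add: q)
  then show ?case
    using bcum_degenerate[OF s, of i d] by (intro lspan_zero) simp
next
  case (Suc k)
  then have i: "i \<in> {0..q}" by auto
  have "lspan {A..<b} (bdiff s d ` {0..q}) (bcum s d (Suc i))"
    using Suc.hyps(2) by (intro Suc.hyps(1)) auto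
  moreover have "lspan {A..<b} (bdiff s d ` {0..q}) (bdiff s d i)"
    using i by (intro lspan_base imageI)
  ultimately have "lspan {A..<b} (bdiff s d ` {0..q}) (\<lambda>x. bdiff s d i x + bcum s d (Suc i) x)"
    by (intro lspan_add)
  then show ?case
    by (rule lspan_cong) (simp add: bdiff_def)
qed

text \<open>The converse inclusion, by induction on the exponent. Exponent 0 gives an indicator,
  which is a \<open>bcum\<close>. For \<open>Suc e\<close>, the power with exponent \<open>e\<close>
  is expanded in B-splines of one degree less; these integrate to multiples of \<open>bcum\<close>,
  which telescope.\<close>

lemma knot_tpow_lspan_bdiff:
  assumes s: "mono s" and A: "\<And>j. A \<le> s j" and q: "\<And>j. q < j \<Longrightarrow> s j = b"
    and "e \<le> d" "s i = s (i + (d - e))"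
  shows "lspan {A..<b} (bdiff s d ` {0..q}) (tpow (s i) e)"
  using assms(4,5)
proof (induction e arbitrary: d)
  case 0
  have "tpow (s i) 0 = bcum s d i"
    using bcum_degenerate[OF s, of i d] 0(2) by (simp add: tpow_def fun_eq_iff)
  then show ?case by (simp only:) (rule bcum_lspan_bdiff[OF s q])
next
  case (Suc e)
  obtain d' where d: "d = Suc d'" using Suc.prems(1) by (cases d) auto
  have "lspan {A..<b} (bdiff s d ` {0..q}) (\<lambda>x. (1 / real (Suc e)) * tpow (s i) (Suc e) x)"
  proof (rule lspan_integral)
    show "lspan {A..<b} (bdiff s d' ` {0..q}) (tpow (s i) e)"
      using Suc.prems by (intro Suc.IH) (simp_all add: d)
    show "\<And>x. x \<in> {A..<b} \<Longrightarrow> {A..x} \<subseteq> {A..<b}" by auto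
    show "(tpow (s i) e has_integral (1 / real (Suc e)) * tpow (s i) (Suc e) x) {A..x}"
      if "x \<in> {A..<b}" for x
      using tpow_has_integral[OF A, of x i e] that by simp
    show "\<exists>G. (\<forall>x\<in>{A..<b}. (f has_integral G x) {A..x}) \<and> lspan {A..<b} (bdiff s d ` {0..q}) G"
      if f: "f \<in> bdiff s d' ` {0..q}" for f
    proof -
      obtain k where k: "f = bdiff s d' k" using f by auto
      define h where "h = (s (k + Suc d') - s k) / real (Suc d')"
      have "(f has_integral h * bcum s d k x) {A..x}" if "x \<in> {A..<b}" for x
        using bdiff_has_integral[OF s A, of x d' k] that by (simp add: h_def k d del: bcum.simps)
      moreover have "lspan {A..<b} (bdiff s d ` {0..q}) (\<lambda>x. h * bcum s d k x)"
        by (intro lspan_scale bcum_lspan_bdiff s q)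
      ultimately show ?thesis by (intro exI[of _ "\<lambda>x. h * bcum s d k x"]) simp
    qed
  qed
  from lspan_scale[OF this, of "real (Suc e)"] show ?case
    by (rule lspan_cong) simp
qed

text \<open>Expanding the factor with the smaller knot about the larger one raises the exponent at the
  larger knot only, so a knot of multiplicity k + 1 has to get multiplicity n + k + 1.\<close>

lemma knot_tpows_mult_lspan:
  assumes s': "mono s'"
    and knots: "\<And>j k. k \<le> n \<Longrightarrow> s j = s (j + k) \<Longrightarrow> s j < b
      \<Longrightarrow> \<exists>j'. s' j' = s j \<and> s' (j' + (n + k)) = s j"
    and "f \<in> knot_tpows s n" "g \<in> knot_tpows s n"
  shows "lspan {A..<b} (knot_tpows s' (2 * n)) (\<lambda>x. f x * g x)"
proof -
  have *: "lspan {A..<b} (knot_tpows s' (2 * n)) (\<lambda>x. tpow (s i) e x * tpow (s j) e' x)"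
    if le: "s i \<le> s j" and e: "e \<le> n" "e' \<le> n" "s j = s (j + (n - e'))" for i j e e'
  proof (cases "s j < b")
    case True
    then obtain j' where j': "s' j' = s j" "s' (j' + (n + (n - e'))) = s j"
      using knots[of "n - e'" j] e by auto
    have "tpow (s j) (e' + l) \<in> knot_tpows s' (2 * n)" if "l \<le> e" for l
    proof -
      \<comment> \<open>The exponent \<open>e' + l\<close> asks for
        \<open>2 * n + 1 - (e' + l)\<close> equal knots, no more than the
        \<open>2 * n + 1 - e'\<close> that start at \<open>j'\<close>.\<close>
      have "s' (j' + (2 * n - (e' + l))) = s' j'"
        by (rule mono_eq_between[OF s', where k = "j' + (n + (n - e'))"]) (use j' e in auto)
      then show ?thesis
        using knot_tpowsI[of "e' + l" "2 * n" s' j'] that e j'(1) by simp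
    qed
    then show ?thesis
      unfolding tpow_mult[OF le] by (intro lspan_sum lspan_scale lspan_base) auto
  next
    \<comment> \<open>A knot not left of \<open>b\<close> gives a power that vanishes on
      \<open>{A..<b}\<close>, which is why multiplicities are demanded only left of
      \<open>b\<close>.\<close>
    case False
    then show ?thesis by (intro lspan_zero) (auto simp: tpow_def)
  qed
  obtain i e j e' where
    f: "f = tpow (s i) e" "e \<le> n" "s i = s (i + (n - e))" and
    g: "g = tpow (s j) e'" "e' \<le> n" "s j = s (j + (n - e'))"
    using assms(3,4) by (auto simp: knot_tpows_def)
  show ?thesis
  proof (cases "s i \<le> s j")
    case True
    then show ?thesis using *[of i j e e'] f g by simp
  next
    case False
    then show ?thesis using *[of j i e' e] f g by (simp add: mult.commute)
  qed
qed

text \<open>Passes from B-splines to truncated powers, multiplies there, and returns to B-splines of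
  degree \<open>2 * n\<close> over \<open>s'\<close>.\<close>

lemma bdiff_mult_coeffs:
  assumes s: "mono s" and A: "\<And>j. A \<le> s j"
    and s': "mono s'" and A': "\<And>j. A \<le> s' j" and q: "\<And>j. q < j \<Longrightarrow> s' j = b"
    and knots: "\<And>j k. k \<le> n \<Longrightarrow> s j = s (j + k) \<Longrightarrow> s j < b
      \<Longrightarrow> \<exists>j'. s' j' = s j \<and> s' (j' + (n + k)) = s j"
  shows "\<exists>c. \<forall>x\<in>{A..<b}. bdiff s n i x * bdiff s n j x = (\<Sum>k\<in>{0..q}. c k * bdiff s' (2 * n) k x)"
proof -
  have bdiff: "lspan {A..<b} (knot_tpows s n) (bdiff s n i)" for i
    unfolding bdiff_def[abs_def] by (intro lspan_diff bcum_lspan_knot_tpows s A)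
  have "lspan {A..<b} (knot_tpows s' (2 * n)) (\<lambda>x. bdiff s n i x * bdiff s n j x)"
    by (rule lspan_mult[OF bdiff bdiff]) (rule knot_tpows_mult_lspan[OF s' knots])
  then have "lspan {A..<b} (bdiff s' (2 * n) ` {0..q}) (\<lambda>x. bdiff s n i x * bdiff s n j x)"
  proof (rule lspan_trans)
    fix f assume "f \<in> knot_tpows s' (2 * n)"
    then show "lspan {A..<b} (bdiff s' (2 * n) ` {0..q}) f"
      unfolding knot_tpows_def by (auto intro!: knot_tpow_lspan_bdiff[OF s' A' q] simp del: diff_diff_left)
  qed
  then show ?thesis by (rule lspan_image_coeffs) simp
qed

section \<open>Clamped knots\<close>

text \<open>For \<open>n \<le> m\<close> and positive \<open>k\<close> these are the entries of
  \<open>clamped_knots e k t n m\<close>, continued past the end of the list by its last knot: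
  \<open>min\<close> caps the index at \<open>m + 1\<close>.\<close>

definition knot_seq :: "nat \<Rightarrow> nat \<Rightarrow> (nat \<Rightarrow> real) \<Rightarrow> nat \<Rightarrow> nat \<Rightarrow> nat \<Rightarrow> real" where
  "knot_seq e k t n m j = t (if j < e then n else min (m + 1) (n + 1 + (j - e) div k))"

lemma length_concat_replicate: "length (concat (map (\<lambda>i. replicate k (f i)) xs)) = k * length xs"
  by (induction xs) auto

lemma nth_concat_replicate:
  assumes "j < k * N"
  shows "concat (map (\<lambda>i. replicate k (f i)) [a..<a + N]) ! j = f (a + j div k)"
  using assms
proof (induction N)
  case (Suc N)
  show ?case
  proof (cases "j < k * N")
    case True
    with Suc.IH show ?thesis by (simp add: nth_append length_concat_replicate)
  next
    case False
    then have "j div k = N" using Suc.prems by (intro div_nat_eqI) (auto simp: mult.commute)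
    with False Suc.prems show ?thesis by (simp add: nth_append length_concat_replicate)
  qed
qed simp

lemma clamped_knots_nth:
  assumes "n \<le> m" "0 < k" "j < length (clamped_knots e k t n m)"
  shows "clamped_knots e k t n m ! j = knot_seq e k t n m j"
proof -
  define xs where "xs = concat (map (\<lambda>i. replicate k (t i)) [n + 1..<m + 1])"
  have len: "length xs = k * (m - n)"
    by (simp add: xs_def length_concat_replicate del: upt_Suc)
  have knots: "clamped_knots e k t n m = replicate e (t n) @ xs @ replicate e (t (m + 1))"
    by (simp add: clamped_knots_def xs_def del: upt_Suc)
  consider "j < e" | "e \<le> j" "j - e < k * (m - n)" | "e \<le> j" "k * (m - n) \<le> j - e" by linarith
  then show ?thesis
  proof cases
    case 1
    then show ?thesis by (simp add: knots knot_seq_def nth_append)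
  next
    case 2
    have "xs ! (j - e) = t (n + 1 + (j - e) div k)"
      using nth_concat_replicate[OF 2(2), of t "n + 1"] assms(1) by (simp add: xs_def del: upt_Suc)
    moreover have "(j - e) div k < m - n"
      using 2(2) by (simp add: less_mult_imp_div_less mult.commute)
    ultimately show ?thesis using 2 len by (simp add: knots knot_seq_def nth_append)
  next
    case 3
    have "m - n \<le> (j - e) div k"
      using div_le_mono[OF 3(2), of k] assms(2) by simp
    moreover have "j - e - k * (m - n) < e"
      using assms(3) 3 by (simp add: length_clamped_knots)
    ultimately show ?thesis using 3 len by (simp add: knots knot_seq_def nth_append)
  qed
qed

lemma last_clamped_knots: "0 < e \<Longrightarrow> last (clamped_knots e k t n m) = t (m + 1)"
  by (simp add: clamped_knots_def)

lemma mono_knot_seq: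
  assumes "mono_on {n..m + 1} t" "n \<le> m"
  shows "mono (knot_seq e k t n m)"
proof (rule monoI)
  fix i j :: nat assume ij: "i \<le> j"
  have "(i - e) div k \<le> (j - e) div k" using ij by (intro div_le_mono) simp
  with ij assms(2) show "knot_seq e k t n m i \<le> knot_seq e k t n m j"
    unfolding knot_seq_def by (intro mono_onD[OF assms(1)]) auto
qed

lemma knot_seq_ge:
  assumes "mono_on {n..m + 1} t" "n \<le> m"
  shows "t n \<le> knot_seq e k t n m j"
  unfolding knot_seq_def using assms(2) by (intro mono_onD[OF assms(1)]) auto

lemma knot_seq_right:
  assumes "0 < k" "n \<le> m" "e + k * (m - n) \<le> j"
  shows "knot_seq e k t n m j = t (m + 1)"
proof -
  have "m - n \<le> (j - e) div k"
    using div_le_mono[of "k * (m - n)" "j - e" k] assms by simp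
  then have "min (m + 1) (n + 1 + (j - e) div k) = m + 1" by linarith
  moreover have "\<not> j < e" using assms(3) by linarith
  ultimately show ?thesis by (simp only: knot_seq_def if_False)
qed

text \<open>The antiderivative has one more copy of the left end knot, so its knots are those of the
  integrand moved by one index.\<close>

lemma knot_seq_Suc: "knot_seq (Suc e) k t n m (Suc j) = knot_seq e k t n m j"
  by (simp add: knot_seq_def)

lemma knot_seq_block:
  assumes "r < k"
  shows "knot_seq e k t n m (e + k * l + r) = t (min (m + 1) (n + 1 + l))"
  using assms by (simp add: knot_seq_def)

text \<open>A run of \<open>k + 1\<close> equal interior knots becomes \<open>k + 1\<close> blocks
  of \<open>n + 1\<close> copies, hence at least \<open>n + k + 1\<close> equal knots. At the left
  end the \<open>2 * n + 1\<close> copies suffice because \<open>k \<le> n\<close>.\<close>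

lemma knot_seq_multiplicity:
  assumes t: "mono_on {n..m + 1} t" and nm: "n \<le> m" and k: "k \<le> n"
    and eq: "knot_seq (n + 1) 1 t n m j = knot_seq (n + 1) 1 t n m (j + k)"
    and less: "knot_seq (n + 1) 1 t n m j < t (m + 1)"
  shows "\<exists>j'. knot_seq (2 * n + 1) (n + 1) t n m j' = knot_seq (n + 1) 1 t n m j \<and>
    knot_seq (2 * n + 1) (n + 1) t n m (j' + (n + k)) = knot_seq (n + 1) 1 t n m j"
proof (cases "j < n + 1")
  case True
  with k show ?thesis by (intro exI[of _ 0]) (simp add: knot_seq_def)
next
  case False
  define l where "l = j - (n + 1)"
  have j: "j = n + 1 + l" using False by (simp add: l_def)
  \<comment> \<open>From index \<open>m + 1\<close> on the knot is \<open>t (m + 1)\<close>,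
    contrary to \<open>less\<close>. Below it, positions in the sequence agree with the indices of
    \<open>t\<close>.\<close>
  have "j + k < m + 1"
    using knot_seq_right[of 1 n m "n + 1" "j + k" t] eq less nm by force
  then have sj: "knot_seq (n + 1) 1 t n m j = t j" "t j = t (j + k)"
    using eq j by (simp_all add: knot_seq_def min_def add.assoc)
  define s where "s = knot_seq (2 * n + 1) (n + 1) t n m"
  \<comment> \<open>\<open>j'\<close> is the first position of the block of \<open>t j\<close> in
    the finer sequence, and \<open>j''\<close> below is the last position of the block of
    \<open>t (j + k)\<close>.\<close>
  define j' where "j' = 2 * n + 1 + (n + 1) * l"
  have s: "mono s" unfolding s_def by (rule mono_knot_seq[OF t nm])
  have "s j' = t j"
    using knot_seq_block[of 0 "n + 1" "2 * n + 1" t n m l] j \<open>j + k < m + 1\<close>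
    by (simp add: s_def j'_def)
  define j'' where "j'' = 2 * n + 1 + (n + 1) * (l + k) + n"
  have "s j'' = t (j + k)"
    using knot_seq_block[of n "n + 1" "2 * n + 1" t n m "l + k"] j \<open>j + k < m + 1\<close>
    by (simp add: s_def j''_def add.assoc)
  with \<open>s j' = t j\<close> sj(2) have eq': "s j' = s j''" by simp
  have "j' + (n + k) \<le> j''"
    by (simp add: j'_def j''_def distrib_left)
  then have "s (j' + (n + k)) = s j'"
    by (intro mono_eq_between[OF s eq']) simp_all
  with \<open>s j' = t j\<close> show ?thesis unfolding sj(1) s_def by (intro exI[of _ j']) simp
qed

section \<open>Curves\<close>

text \<open>Ties a finite knot list to an infinite monotone sequence, so that B-splines over the
  list can be replaced by \<open>bdiff\<close>.\<close>

locale knot_list =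
  fixes \<mu> :: "real list" and s :: "nat \<Rightarrow> real" and A b :: real
  assumes mono: "mono s" and nth: "\<And>j. j < length \<mu> \<Longrightarrow> \<mu> ! j = s j"
    and lower: "\<And>j. A \<le> s j" and last: "last \<mu> = b" and less: "A < b"
begin

text \<open>\<open>Lim\<close> has the intended value only if the limit exists; the expansion in
  truncated powers provides its existence.\<close>

lemma clamped_bspline_left_limit:
  assumes "i + d + 1 < length \<mu>"
  shows "(bdiff s d i \<longlongrightarrow> clamped_bspline \<mu> d i b) (at_left b)"
proof -
  obtain l where l: "(bdiff s d i \<longlongrightarrow> l) (at_left b)"
    using lspan_tpows_from_left_limit[OF bdiff_lspan_tpows_from[of A s "{A..<b}" d i, OF lower] less]
    by blast
  have "bspline \<mu> d i = bdiff s d i"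
    using bspline_eq_bdiff[OF mono nth assms] by auto
  then have "clamped_bspline \<mu> d i b = l"
    using tendsto_Lim[OF _ l] by (simp add: clamped_bspline_def last)
  with l show ?thesis by simp
qed

lemma bspline_curve_eq:
  assumes "N + d + 1 < length \<mu>" "x \<noteq> b"
  shows "bspline_curve \<mu> d N c x = (\<Sum>i = 0..N. c i * complex_of_real (bdiff s d i x))"
  unfolding bspline_curve_def
proof (intro sum.cong refl)
  fix i assume "i \<in> {0..N}"
  then have "bspline \<mu> d i x = bdiff s d i x"
    using assms(1) by (intro bspline_eq_bdiff mono nth) auto
  then show "c i * complex_of_real (clamped_bspline \<mu> d i x) = c i * complex_of_real (bdiff s d i x)"
    using assms(2) by (simp add: clamped_bspline_def last)
qed

lemma bspline_curve_left_limit: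
  assumes "N + d + 1 < length \<mu>"
  shows "((\<lambda>x. \<Sum>i = 0..N. c i * complex_of_real (bdiff s d i x)) \<longlongrightarrow> bspline_curve \<mu> d N c b)
    (at_left b)"
  unfolding bspline_curve_def
  using assms
  by (intro tendsto_sum tendsto_mult tendsto_const tendsto_of_real clamped_bspline_left_limit) auto

end

section \<open>Integrating and squaring curves\<close>

lemma bdiff_curve_has_integral:
  fixes p :: "nat \<Rightarrow> complex"
  assumes "mono s" "\<And>j. A \<le> s j" "A \<le> x"
  shows "((\<lambda>x. \<Sum>i = 0..q. p i * complex_of_real (bdiff s d i x)) has_integral
    (\<Sum>i = 0..q. p i * complex_of_real
      ((s (i + Suc d) - s i) / real (Suc d) * bcum s (Suc d) i x))) {A..x}"
proof (intro has_integral_sum has_integral_mult_right finite_atLeastAtMost)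
  fix i
  show "((\<lambda>x. complex_of_real (bdiff s d i x)) has_integral
      complex_of_real ((s (i + Suc d) - s i) / real (Suc d) * bcum s (Suc d) i x)) {A..x}"
    by (intro has_integral_of_real bdiff_has_integral assms)
qed

lemma sum_by_parts:
  fixes r g :: "nat \<Rightarrow> complex"
  shows "(\<Sum>i = 0..Suc q. r i * (g i - g (Suc i)))
    = r 0 * g 0 + (\<Sum>i = 0..q. (r (Suc i) - r i) * g (Suc i)) - r (Suc q) * g (Suc (Suc q))"
  by (induction q) (simp_all add: algebra_simps)

text \<open>Summation by parts leaves the increments of \<open>r\<close> times cumulative splines,
  and the recursion for \<open>r\<close> supplies exactly the factor of the integral formula. The
  first cumulative spline is 1 because \<open>s\<close> starts with \<open>d + 2\<close> copies of
  \<open>A\<close>.\<close>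

lemma bdiff_curve_antiderivative:
  fixes p r :: "nat \<Rightarrow> complex"
  assumes s: "mono s" and s': "\<And>j. s (Suc j) = s' j"
    and A: "s 0 = A" "s (Suc d) = A" and q: "\<And>j. q < j \<Longrightarrow> s' j = b"
    and r: "\<And>i. i \<le> q \<Longrightarrow> r (Suc i) = r i
      + complex_of_real ((s' (i + Suc d) - s' i) / real (Suc d)) * p i"
    and x: "A \<le> x" "x < b"
  shows "(\<Sum>i = 0..Suc q. r i * complex_of_real (bdiff s (Suc d) i x))
    = r 0 + (\<Sum>i = 0..q. p i * complex_of_real
      ((s' (i + Suc d) - s' i) / real (Suc d) * bcum s' (Suc d) i x))"
proof -
  define g where "g i = complex_of_real (bcum s (Suc d) i x)" for i
  have g: "g (Suc i) = complex_of_real (bcum s' (Suc d) i x)" for i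
    unfolding g_def bcum_shift s' ..
  have "g 0 = 1"
    using bcum_degenerate[OF s, of 0 "Suc d" x] A x by (simp add: g_def del: bcum.simps)
  \<comment> \<open>Index \<open>Suc (Suc q)\<close> of \<open>s\<close> is index
    \<open>Suc q\<close> of \<open>s'\<close>, from which on all knots equal
    \<open>b\<close>.\<close>
  moreover have "g (Suc (Suc q)) = 0"
    using bcum_degenerate[OF s, of "Suc (Suc q)" "Suc d" x] x
    by (simp add: g_def s' q del: bcum.simps)
  ultimately have "(\<Sum>i = 0..Suc q. r i * (g i - g (Suc i)))
      = r 0 + (\<Sum>i = 0..q. (r (Suc i) - r i) * g (Suc i))"
    by (simp only: sum_by_parts mult_1_right mult_zero_right diff_zero)
  moreover have "complex_of_real (bdiff s (Suc d) i x) = g i - g (Suc i)" for i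
    by (simp add: bdiff_def g_def del: bcum.simps)
  moreover have "(\<Sum>i = 0..q. (r (Suc i) - r i) * g (Suc i)) = (\<Sum>i = 0..q. p i * complex_of_real
      ((s' (i + Suc d) - s' i) / real (Suc d) * bcum s' (Suc d) i x))"
    by (intro sum.cong refl) (simp add: r g del: bcum.simps)
  ultimately show ?thesis by simp
qed

lemma square_bdiff_curve:
  fixes z :: "nat \<Rightarrow> complex"
  assumes "\<And>i j. N i * N j = (\<Sum>k\<in>{0..q}. C i j k * M k)"
  shows "(\<Sum>i = 0..m. z i * complex_of_real (N i))\<^sup>2
    = (\<Sum>k = 0..q. (\<Sum>i = 0..m. \<Sum>j = 0..m. z i * z j * complex_of_real (C i j k))
        * complex_of_real (M k))"
proof -
  have "(\<Sum>i = 0..m. z i * complex_of_real (N i))\<^sup>2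
      = (\<Sum>i = 0..m. \<Sum>j = 0..m. z i * z j * complex_of_real (N i * N j))"
    unfolding power2_eq_square sum_product by (intro sum.cong refl) (simp add: mult_ac)
  also have "\<dots> = (\<Sum>i = 0..m. \<Sum>j = 0..m. \<Sum>k = 0..q.
      z i * z j * complex_of_real (C i j k) * complex_of_real (M k))"
    unfolding assms by (intro sum.cong refl) (simp add: sum_distrib_left mult.assoc)
  also have "\<dots> = (\<Sum>i = 0..m. \<Sum>k = 0..q. \<Sum>j = 0..m.
      z i * z j * complex_of_real (C i j k) * complex_of_real (M k))"
    by (intro sum.cong refl) (rule sum.swap)
  also have "\<dots> = (\<Sum>k = 0..q. \<Sum>i = 0..m. \<Sum>j = 0..m.
      z i * z j * complex_of_real (C i j k) * complex_of_real (M k))"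
    by (rule sum.swap)
  finally show ?thesis by (simp only: sum_distrib_right)
qed

text \<open>An indefinite integral is continuous, so its value at \<open>b\<close> is the left limit
  that the convention at the right end calls for.\<close>

lemma has_integral_left_limit:
  fixes f :: "real \<Rightarrow> complex"
  assumes "A < b" and V: "\<And>x. A \<le> x \<Longrightarrow> x \<le> b \<Longrightarrow> (f has_integral V x) {A..x}"
  shows "(V \<longlongrightarrow> V b) (at_left b)"
proof -
  have f: "f integrable_on {A..b}" using V[of b] assms(1) by auto
  have "continuous_on {A..b} (\<lambda>x. integral {A..x} f)"
    by (rule indefinite_integral_continuous_1[OF f])
  then have "continuous_on {A..b} V"
    by (rule continuous_on_eq) (use V in auto)
  then show ?thesis
    by (rule continuous_on_Icc_at_leftD[OF _ assms(1)])
qed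

section \<open>The squared curve and its indefinite integral\<close>

theorem corollary1:
  fixes m n q :: nat and t :: "nat \<Rightarrow> real" and z :: "nat \<Rightarrow> complex"
    and \<mu> \<nu> \<rho> :: "real list"
  assumes "1 \<le> n" and "n \<le> m"
    and "mono_on {n..m + 1} t" and "t n < t (m + 1)"
    and "\<mu> = clamped_knots (n + 1) 1 t n m"
    and "q = 2 * n + (n + 1) * (m - n)"
    and "\<nu> = clamped_knots (2 * n + 1) (n + 1) t n m"
    and "\<rho> = clamped_knots (2 * n + 2) (n + 1) t n m"
  shows "\<exists>p :: nat \<Rightarrow> complex.
    (\<forall>x\<in>{t n..t (m + 1)}. (bspline_curve \<mu> n m z x)\<^sup>2 = bspline_curve \<nu> (2 * n) q p x) \<and>
    (\<forall>(r0 :: complex) (r :: nat \<Rightarrow> complex).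
       r 0 = r0 \<longrightarrow>
       (\<forall>i\<in>{0..q}. r (i + 1) =
          r i + complex_of_real ((\<nu> ! (i + 2 * n + 1) - \<nu> ! i) / real (2 * n + 1)) * p i) \<longrightarrow>
       (\<forall>x\<in>{t n..t (m + 1)}.
          (bspline_curve \<nu> (2 * n) q p has_integral
             (bspline_curve \<rho> (2 * n + 1) (q + 1) r x
              - bspline_curve \<rho> (2 * n + 1) (q + 1) r (t n))) {t n..x}))"
proof -
  note nm = assms(2) and t = assms(3) and tless = assms(4)
  define s\<^sub>0 where "s\<^sub>0 = knot_seq (n + 1) 1 t n m"
  define s\<^sub>1 where "s\<^sub>1 = knot_seq (2 * n + 1) (n + 1) t n m"
  define s\<^sub>2 where "s\<^sub>2 = knot_seq (2 * n + 2) (n + 1) t n m"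
  note s_defs = s\<^sub>0_def s\<^sub>1_def s\<^sub>2_def
  have knot_list: "knot_list (clamped_knots e k t n m) (knot_seq e k t n m) (t n) (t (m + 1))"
    if "0 < e" "0 < k" for e k
    using that nm t tless
    by unfold_locales (simp_all add: mono_knot_seq clamped_knots_nth knot_seq_ge last_clamped_knots)
  interpret M: knot_list \<mu> s\<^sub>0 "t n" "t (m + 1)"
    unfolding assms(5) s_defs by (rule knot_list) simp_all
  interpret N: knot_list \<nu> s\<^sub>1 "t n" "t (m + 1)"
    unfolding assms(7) s_defs by (rule knot_list) simp_all
  interpret R: knot_list \<rho> s\<^sub>2 "t n" "t (m + 1)"
    unfolding assms(8) s_defs by (rule knot_list) simp_all
  have lengths: "m + n + 1 < length \<mu>" "q + 2 * n + 1 < length \<nu>"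
      "(q + 1) + (2 * n + 1) + 1 < length \<rho>"
    using nm by (simp_all add: assms(5-8) length_clamped_knots)
  \<comment> \<open>\<open>q + 1\<close> equals \<open>2 * n + 1 + (n + 1) * (m - n)\<close>, the
    position in \<open>\<nu>\<close> where the final block of copies of \<open>t (m + 1)\<close>
    begins.\<close>
  have right: "s\<^sub>1 j = t (m + 1)" if "q < j" for j
    unfolding s\<^sub>1_def using that nm assms(6) by (intro knot_seq_right) simp_all
  have shift: "s\<^sub>2 (Suc j) = s\<^sub>1 j" for j
    using knot_seq_Suc[of "2 * n + 1" "n + 1" t n m j] by (simp add: s_defs)
  have "\<exists>c. \<forall>x\<in>{t n..<t (m + 1)}.
      bdiff s\<^sub>0 n i x * bdiff s\<^sub>0 n j x = (\<Sum>k\<in>{0..q}. c k * bdiff s\<^sub>1 (2 * n) k x)" for i j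
    using M.mono M.lower N.mono N.lower right
  proof (rule bdiff_mult_coeffs)
    fix j k assume "k \<le> n" "s\<^sub>0 j = s\<^sub>0 (j + k)" "s\<^sub>0 j < t (m + 1)"
    then show "\<exists>j'. s\<^sub>1 j' = s\<^sub>0 j \<and> s\<^sub>1 (j' + (n + k)) = s\<^sub>0 j"
      unfolding s_defs by (rule knot_seq_multiplicity[OF t nm])
  qed
  \<comment> \<open>Coefficients are chosen for all pairs \<open>i\<close>, \<open>j\<close> at once
    and do not depend on \<open>x\<close>.\<close>
  then obtain C where C: "\<And>i j x. x \<in> {t n..<t (m + 1)} \<Longrightarrow>
      bdiff s\<^sub>0 n i x * bdiff s\<^sub>0 n j x = (\<Sum>k\<in>{0..q}. C i j k * bdiff s\<^sub>1 (2 * n) k x)"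
    by metis
  define p where "p k = (\<Sum>i = 0..m. \<Sum>j = 0..m. z i * z j * complex_of_real (C i j k))" for k
  define f where "f x = (\<Sum>k = 0..q. p k * complex_of_real (bdiff s\<^sub>1 (2 * n) k x))" for x
  define V where "V x = (\<Sum>k = 0..q. p k * complex_of_real
      ((s\<^sub>1 (k + Suc (2 * n)) - s\<^sub>1 k) / real (Suc (2 * n)) * bcum s\<^sub>1 (Suc (2 * n)) k x))" for x
  have near: "\<forall>\<^sub>F x in at_left (t (m + 1)). x \<in> {t n..<t (m + 1)}"
    using eventually_at_left_real[OF tless] by eventually_elim auto
  have square: "(\<Sum>i = 0..m. z i * complex_of_real (bdiff s\<^sub>0 n i x))\<^sup>2 = f x"
    if "x \<in> {t n..<t (m + 1)}" for x
    unfolding f_def p_def by (rule square_bdiff_curve) (rule C[OF that])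
  have f_left: "(f \<longlongrightarrow> bspline_curve \<nu> (2 * n) q p (t (m + 1))) (at_left (t (m + 1)))"
    unfolding f_def[abs_def] by (rule N.bspline_curve_left_limit[OF lengths(2)])
  have V: "(f has_integral V x) {t n..x}" if "t n \<le> x" for x
    unfolding f_def[abs_def] V_def
    by (rule bdiff_curve_has_integral[OF N.mono N.lower that])
  have "(bspline_curve \<mu> n m z x)\<^sup>2 = bspline_curve \<nu> (2 * n) q p x"
    if x: "x \<in> {t n..t (m + 1)}" for x
  proof (cases "x = t (m + 1)")
    case True
    \<comment> \<open>Both curves take left limits at the right end, so the equality on the
      half-open interval passes to it by uniqueness of limits.\<close>
    have "((\<lambda>x. (\<Sum>i = 0..m. z i * complex_of_real (bdiff s\<^sub>0 n i x))\<^sup>2) \<longlongrightarrow>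
        (bspline_curve \<mu> n m z (t (m + 1)))\<^sup>2) (at_left (t (m + 1)))"
      by (intro tendsto_power M.bspline_curve_left_limit lengths)
    then have "(f \<longlongrightarrow> (bspline_curve \<mu> n m z (t (m + 1)))\<^sup>2) (at_left (t (m + 1)))"
      by (rule Lim_transform_eventually) (use near in eventually_elim, rule square)
    from tendsto_unique[OF _ this f_left] True show ?thesis by simp
  next
    case False
    with square[of x] x show ?thesis
      by (simp add: M.bspline_curve_eq[OF lengths(1)] N.bspline_curve_eq[OF lengths(2)] f_def)
  qed
  moreover have "(bspline_curve \<nu> (2 * n) q p has_integral
      (bspline_curve \<rho> (2 * n + 1) (q + 1) r x - bspline_curve \<rho> (2 * n + 1) (q + 1) r (t n)))
      {t n..x}"
    if r: "\<forall>i\<in>{0..q}. r (i + 1) =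
        r i + complex_of_real ((\<nu> ! (i + 2 * n + 1) - \<nu> ! i) / real (2 * n + 1)) * p i"
      and x: "x \<in> {t n..t (m + 1)}" for r x
  proof -
    let ?g = "\<lambda>x. \<Sum>i = 0..q + 1. r i * complex_of_real (bdiff s\<^sub>2 (2 * n + 1) i x)"
    have g: "?g x = r 0 + V x" if "x \<in> {t n..<t (m + 1)}" for x
    proof -
      have "(\<Sum>i = 0..Suc q. r i * complex_of_real (bdiff s\<^sub>2 (Suc (2 * n)) i x)) = r 0 + V x"
        unfolding V_def
      proof (rule bdiff_curve_antiderivative[OF R.mono shift _ _ right])
        show "s\<^sub>2 0 = t n" "s\<^sub>2 (Suc (2 * n)) = t n" by (simp_all add: s_defs knot_seq_def)
        show "r (Suc i) = r i +
            complex_of_real ((s\<^sub>1 (i + Suc (2 * n)) - s\<^sub>1 i) / real (Suc (2 * n))) * p i"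
          if "i \<le> q" for i
          using bspec[OF r, of i] that lengths(2) N.nth[of "i + 2 * n + 1"] N.nth[of i] by simp
      qed (use that in auto)
      then show ?thesis by simp
    qed
    have R: "bspline_curve \<rho> (2 * n + 1) (q + 1) r x = r 0 + V x"
      if "x \<in> {t n..t (m + 1)}" for x
    proof (cases "x = t (m + 1)")
      case True
      \<comment> \<open>Continuity of the integral gives \<open>r 0 + V x\<close> the left limit
        \<open>r 0 + V (t (m + 1))\<close>, and the value of the curve over \<open>\<rho>\<close> is
        the left limit of the same function.\<close>
      have "((\<lambda>x. r 0 + V x) \<longlongrightarrow> r 0 + V (t (m + 1))) (at_left (t (m + 1)))"
        by (intro tendsto_intros has_integral_left_limit[OF tless V])
      moreover have "((\<lambda>x. r 0 + V x) \<longlongrightarrow> bspline_curve \<rho> (2 * n + 1) (q + 1) r (t (m + 1)))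
          (at_left (t (m + 1)))"
        using R.bspline_curve_left_limit[OF lengths(3)]
        by (rule Lim_transform_eventually) (use near in eventually_elim, rule g)
      ultimately show ?thesis using tendsto_unique[of "at_left (t (m + 1))"] True by auto
    next
      case False
      with g[of x] that R.bspline_curve_eq[OF lengths(3), of x r] show ?thesis by simp
    qed
    \<comment> \<open>Hence the curve over \<open>\<rho>\<close> starts at \<open>r 0\<close>, and
      the difference in the claim is \<open>V x\<close>.\<close>
    have "V (t n) = 0"
      using has_integral_unique[OF V[of "t n"]] by (simp add: has_integral_refl(2))
    \<comment> \<open>On the interval \<open>f\<close> and the curve over \<open>\<nu>\<close> can
      differ only at the right end, a single point.\<close>
    moreover have "(bspline_curve \<nu> (2 * n) q p has_integral V x) {t n..x}"
      using x by (intro has_integral_spike_finite[OF _ _ V, of "{t (m + 1)}"])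
        (auto simp: N.bspline_curve_eq[OF lengths(2)] f_def)
    ultimately show ?thesis using R[OF x] R[of "t n"] tless by simp
  qed
  ultimately show ?thesis by (intro exI[of _ p]) blast
qed

end
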